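(* Let $n\in\mathbb N$. If $S\subset M_n$ is an operator system, then the lattice of ground state projections $\mathcal P(S)$ is coatomistic.
   Context: $M_n$ is the algebra of complex $n$-by-$n$ matrices with identity $\mathbb 1$. An operator system $S\subset M_n$ is a complex vector subspace which contains $\mathbb 1$ and is self-adjoint ($s\in S$ implies $s^*\in S$); $S_{\rm h}$ is the real space of hermitian matrices in $S$. For a hermitian matrix $u\in M_n$ the ground state projection $p_-(u)$ is the spectral projection of $u$ for its least eigenvalue, i.e. the orthogonal projection onto the eigenspace of the least eigenvalue. The set of ground state projections of $S_{\rm h}$ is $\mathcal P(S):=\{p_-(s)\mid s\in S_{\rm h}\}\cup\{0\}$ (its elements need not lie in $S$), partially ordered by $a\preceq b$ iff $b-a$ is positive semi-definite (equivalently, by inclusion of images). It is a lattice with smallest element $0$ and greatest element $\mathbb 1$, whose infimum is the restriction of the infimum in the lattice of all orthogonal projections of $M_n$ (intersection of images). A coatom of a lattice with greatest element $1$ is an element $x\ne1$ such that $y\ge x$, $y\ne x$ implies $y=1$. A lattice with greatest element is coatomistic if every element is the infimum of the coatoms in which it is contained (the coatoms that are $\geq$ it). *)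

theory Defs
  imports "HOL-Analysis.Analysis" "HOL-Algebra.Lattice"
begin

text \<open>
  The algebra $M_n$ is the type \<^typ>\<open>complex^'n^'n\<close> with $n$ the cardinality of the finite
  (and hence nonempty) index type, product \<open>**\<close> and identity \<^term>\<open>mat 1\<close>.
\<close>

definition cmat_scale :: "complex \<Rightarrow> complex^'n^'m \<Rightarrow> complex^'n^'m" where
  "cmat_scale c A = (\<chi> i j. c * A $ i $ j)"

text \<open>
  \<open>*s\<close> does not provide complex scalar multiplication of matrices; the interpretation makes
  \<open>cmat.subspace\<close> the notion of complex subspace.
\<close>

global_interpretation cmat: vector_space "cmat_scale :: complex \<Rightarrow> complex^'n^'m \<Rightarrow> complex^'n^'m"
  by unfold_locales (simp_all add: cmat_scale_def vec_eq_iff algebra_simps)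

definition adjoint_matrix :: "complex^'n^'m \<Rightarrow> complex^'m^'n" where
  "adjoint_matrix A = (\<chi> i j. cnj (A $ j $ i))"

definition hermitian :: "complex^'n^'n \<Rightarrow> bool" where
  "hermitian A \<longleftrightarrow> adjoint_matrix A = A"

text \<open>
  The real inner product \<open>x \<bullet> y\<close> on \<^typ>\<open>complex^'n\<close> is the real part of the standard hermitian
  inner product. The hermitian form \<open>\<langle>x, A x\<rangle>\<close> is real for hermitian \<open>A\<close>, so it equals
  \<open>x \<bullet> (A *v x)\<close>.
\<close>

definition pos_semidef :: "complex^'n^'n \<Rightarrow> bool" where
  "pos_semidef A \<longleftrightarrow> hermitian A \<and> (\<forall>x. 0 \<le> x \<bullet> (A *v x))"

definition operator_system :: "(complex^'n^'n) set \<Rightarrow> bool" where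
  "operator_system S \<longleftrightarrow>
     cmat.subspace S \<and> mat 1 \<in> S \<and> (\<forall>s\<in>S. adjoint_matrix s \<in> S)"

definition hermitian_part :: "(complex^'n^'n) set \<Rightarrow> (complex^'n^'n) set" where
  "hermitian_part S = {s \<in> S. hermitian s}"

definition eigenspace :: "complex^'n^'n \<Rightarrow> complex \<Rightarrow> (complex^'n) set" where
  "eigenspace A k = {x. A *v x = k *s x}"

definition eigenvalue :: "complex^'n^'n \<Rightarrow> complex \<Rightarrow> bool" where
  "eigenvalue A k \<longleftrightarrow> (\<exists>x\<in>eigenspace A k. x \<noteq> 0)"

text \<open>Only used for hermitian matrices, all of whose eigenvalues are real.\<close>

definition least_eigenvalue :: "complex^'n^'n \<Rightarrow> real" where
  "least_eigenvalue A = (LEAST l. eigenvalue A (complex_of_real l))"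

definition orthogonal_projection :: "complex^'n^'n \<Rightarrow> bool" where
  "orthogonal_projection P \<longleftrightarrow> hermitian P \<and> P ** P = P"

definition projection_onto :: "(complex^'n) set \<Rightarrow> complex^'n^'n" where
  "projection_onto E = (THE P. orthogonal_projection P \<and> range ((*v) P) = E)"

definition ground_projection :: "complex^'n^'n \<Rightarrow> complex^'n^'n" where
  "ground_projection u = projection_onto (eigenspace u (complex_of_real (least_eigenvalue u)))"

definition ground_projections :: "(complex^'n^'n) set \<Rightarrow> (complex^'n^'n) set" where
  "ground_projections S = ground_projection ` hermitian_part S \<union> {0}"

definition ground_projection_order :: "(complex^'n^'n) set \<Rightarrow> (complex^'n^'n) gorder" where
  "ground_projection_order S =
     \<lparr>carrier = ground_projections S, eq = (=), le = (\<lambda>a b. pos_semidef (b - a))\<rparr>"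

definition coatom :: "('a, 'b) gorder_scheme \<Rightarrow> 'a \<Rightarrow> bool" where
  "coatom L x \<longleftrightarrow> x \<in> carrier L \<and> x \<noteq> \<top>\<^bsub>L\<^esub> \<and>
     (\<forall>y\<in>carrier L. x \<sqsubseteq>\<^bsub>L\<^esub> y \<and> y \<noteq> x \<longrightarrow> y = \<top>\<^bsub>L\<^esub>)"

text \<open>
  Infima are taken in \<open>L\<close> itself; that of the empty set, needed for the greatest element, is the
  greatest element.
\<close>

locale coatomistic_lattice = Lattice.lattice L + weak_partial_order_top L for L (structure) +
  assumes is_glb_coatoms: "x \<in> carrier L \<Longrightarrow> is_glb L x {c. coatom L c \<and> x \<sqsubseteq> c}"

end

theory Submission
  imports Defs
begin

text \<open>
  Subtracting the least eigenvalue \<open>l\<close> from a hermitian \<open>u \<in> S\<close> gives a positive semi-definite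
  element \<open>u - l 1\<close> of \<open>S\<close> whose kernel is the ground space of \<open>u\<close>. Hence the ground state
  projections are the orthogonal projections onto the kernels of the positive semi-definite elements
  of \<open>S\<close>; the projection \<open>0\<close> belongs to the kernel of \<open>1\<close>. For projections onto subspaces the
  positive semi-definite order is inclusion of the subspaces, so the statement is about the family
  of these kernels ordered by inclusion. The family contains the whole space, the kernel of \<open>0\<close>,
  and is closed under intersection because \<open>ker s \<inter> ker t = ker (s + t)\<close>. As dimensions are
  finite, this makes it a lattice.

  To see that every kernel is an intersection of coatoms, let \<open>ker s\<close> be neither a coatom nor the
  whole space, so that \<open>ker s \<subset> ker t\<close> for some positive semi-definite \<open>t \<in> S\<close>, \<open>t \<noteq> 0\<close>.
  Subtract from \<open>s\<close> the largest multiple \<open>c t\<close> for which \<open>u = s - c t\<close> stays positive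
  semi-definite. By maximality \<open>u\<close> has a zero vector that \<open>s\<close> does not have
  (lemma \<open>exists_larger_kernel\<close>), and \<open>s = u + c t\<close> yields \<open>ker s = ker u \<inter> ker t\<close>. Both
  kernels on the right are strictly larger than \<open>ker s\<close>, and induction on the codimension
  finishes the argument (lemma \<open>coatoms_separate\<close>). In convex terms, a nonzero point of the cone of
  positive semi-definite elements of \<open>S\<close> that lies on no extreme ray is split into two points of
  smaller faces.
\<close>

section \<open>Hermitian matrices over the real inner product\<close>

lemma inner_adjoint_matrix:
  fixes A :: "complex^'n^'m"
  shows "(A *v x) \<bullet> y = x \<bullet> (adjoint_matrix A *v y)"
proof -
  have "(A *v x) \<bullet> y = (\<Sum>i\<in>UNIV. \<Sum>j\<in>UNIV. (A$i$j * x$j) \<bullet> y$i)"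
    by (simp add: inner_vec_def matrix_vector_mult_def inner_sum_left)
  also have "\<dots> = (\<Sum>j\<in>UNIV. \<Sum>i\<in>UNIV. (A$i$j * x$j) \<bullet> y$i)"
    by (rule sum.swap)
  also have "\<dots> = (\<Sum>j\<in>UNIV. \<Sum>i\<in>UNIV. x$j \<bullet> (cnj (A$i$j) * y$i))"
    by (simp add: inner_complex_def algebra_simps)
  also have "\<dots> = x \<bullet> (adjoint_matrix A *v y)"
    by (simp add: inner_vec_def matrix_vector_mult_def inner_sum_right adjoint_matrix_def)
  finally show ?thesis .
qed

text \<open>
  Self-adjointness for the real part of the hermitian inner product already gives self-adjointness
  for the hermitian inner product. This is why the real Euclidean theory suffices throughout.
\<close>

lemma hermitian_iff_inner:
  fixes A :: "complex^'n^'n"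
  shows "hermitian A \<longleftrightarrow> (\<forall>x y. (A *v x) \<bullet> y = x \<bullet> (A *v y))"
proof
  assume "hermitian A"
  then show "\<forall>x y. (A *v x) \<bullet> y = x \<bullet> (A *v y)"
    by (simp add: inner_adjoint_matrix hermitian_def)
next
  assume *: "\<forall>x y. (A *v x) \<bullet> y = x \<bullet> (A *v y)"
  have "adjoint_matrix A *v y = A *v y" for y
  proof -
    have "\<forall>x. x \<bullet> (adjoint_matrix A *v y) = x \<bullet> (A *v y)"
      using * by (simp flip: inner_adjoint_matrix)
    then show ?thesis
      by (simp add: vector_eq_ldot)
  qed
  then show "hermitian A"
    by (simp add: hermitian_def matrix_eq)
qed

lemma scaleR_mult_vec [simp]:
  fixes A :: "complex^'n^'m"
  shows "(r *\<^sub>R A) *v x = r *\<^sub>R (A *v x)"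
  by (simp add: matrix_vector_mult_def vec_eq_iff scaleR_sum_right)

lemma mult_vec_scaleR:
  fixes A :: "complex^'n^'m"
  shows "A *v (r *\<^sub>R x) = r *\<^sub>R (A *v x)"
  using linear_iff matrix_vector_mul_linear by blast

lemma scaleR_eq_cmat_scale: "r *\<^sub>R A = cmat_scale (complex_of_real r) A"
  by (simp add: cmat_scale_def vec_eq_iff) (simp add: scaleR_conv_of_real)

lemma of_real_smult_eq_scaleR: "complex_of_real r *s x = r *\<^sub>R x"
  by (simp add: vec_eq_iff) (simp add: scaleR_conv_of_real)

definition ker :: "complex^'n^'m \<Rightarrow> (complex^'n) set" where
  "ker A = {x. A *v x = 0}"

lemma ker_zero [simp]: "ker 0 = UNIV"
  and ker_one [simp]: "ker (mat 1) = {0}"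
  by (auto simp: ker_def)

lemma vec_subspace_ker: "vec.subspace (ker A)"
  by (simp add: ker_def vec.subspace_def matrix_vector_right_distrib vector_scalar_commute)

lemma vec_subspace_imp_subspace:
  fixes E :: "(complex^'n) set"
  assumes "vec.subspace E"
  shows "subspace E"
  using assms unfolding vec.subspace_def subspace_def
  by (metis of_real_smult_eq_scaleR)

lemma subspace_ker: "subspace (ker A)"
  by (simp add: vec_subspace_imp_subspace vec_subspace_ker)

lemma hermitian_zero [simp]: "hermitian 0"
  and hermitian_one [simp]: "hermitian (mat 1)"
  by (simp_all add: hermitian_iff_inner)

lemma hermitian_add: "hermitian A \<Longrightarrow> hermitian B \<Longrightarrow> hermitian (A + B)"
  and hermitian_diff: "hermitian A \<Longrightarrow> hermitian B \<Longrightarrow> hermitian (A - B)"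
  and hermitian_scaleR: "hermitian A \<Longrightarrow> hermitian (r *\<^sub>R A)"
  by (simp_all add: hermitian_iff_inner algebra_simps inner_add_left inner_diff_left
      inner_add_right inner_diff_right)

text \<open>
  If the form vanishes at \<open>x\<close>, then moving from \<open>x\<close> a small distance \<open>t\<close> against the gradient
  \<open>y = A x\<close> would make it negative, as it changes by \<open>- 2 t |y|\<^sup>2 + O(t\<^sup>2)\<close>, unless \<open>y = 0\<close>.
\<close>

lemma pos_semidef_inner_zero_iff:
  assumes "pos_semidef A"
  shows "x \<bullet> (A *v x) = 0 \<longleftrightarrow> A *v x = 0"
proof
  assume x: "x \<bullet> (A *v x) = 0"
  define y where "y = A *v x"
  define r where "r = y \<bullet> (A *v y)"
  have herm: "(A *v v) \<bullet> w = v \<bullet> (A *v w)" for v w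
    using assms by (simp add: pos_semidef_def hermitian_iff_inner)
  have "0 \<le> - 2 * t * (y \<bullet> y) + t\<^sup>2 * r" for t
  proof -
    have "0 \<le> (x - t *\<^sub>R y) \<bullet> (A *v (x - t *\<^sub>R y))"
      using assms by (simp add: pos_semidef_def)
    also have "\<dots> = - 2 * t * (y \<bullet> y) + t\<^sup>2 * r"
      using x herm[of x y]
      by (simp add: y_def[symmetric] r_def matrix_vector_mult_diff_distrib mult_vec_scaleR
          inner_diff_left inner_diff_right power2_eq_square algebra_simps)
    finally show ?thesis .
  qed
  note quad = this
  have "r \<ge> 0"
    using assms by (simp add: r_def pos_semidef_def)
  have "y \<bullet> y \<le> 0"
  proof (rule ccontr)
    assume "\<not> y \<bullet> y \<le> 0"
    then have pos: "y \<bullet> y > 0" by linarith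
    \<comment> \<open>The quadratic is negative for \<open>0 < t < 2 (y \<bullet> y) / r\<close>; the summand 1 covers \<open>r = 0\<close>.\<close>
    define t where "t = (y \<bullet> y) / (r + 1)"
    have "t > 0" using pos \<open>r \<ge> 0\<close> by (simp add: t_def)
    have "t * (r + 1) = y \<bullet> y" using \<open>r \<ge> 0\<close> by (simp add: t_def)
    then have "t * r < 2 * (y \<bullet> y)" using \<open>t > 0\<close> pos unfolding distrib_left by linarith
    then have "t * (t * r) < t * (2 * (y \<bullet> y))" using \<open>t > 0\<close> by simp
    then show False using quad[of t] by (simp add: power2_eq_square algebra_simps)
  qed
  then show "A *v x = 0"
    using inner_gt_zero_iff[of "A *v x"] unfolding y_def by linarith
qed simp

lemma pos_semidef_zero [simp]: "pos_semidef 0"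
  and pos_semidef_one [simp]: "pos_semidef (mat 1)"
  by (simp_all add: pos_semidef_def)

lemma pos_semidef_add: "pos_semidef A \<Longrightarrow> pos_semidef B \<Longrightarrow> pos_semidef (A + B)"
  by (simp add: pos_semidef_def hermitian_add matrix_vector_mult_add_rdistrib inner_add_right)

lemma ker_add:
  assumes "pos_semidef A" "pos_semidef B"
  shows "ker (A + B) = ker A \<inter> ker B"
proof -
  have "A *v x = 0 \<and> B *v x = 0" if "(A + B) *v x = 0" for x
  proof -
    have "x \<bullet> (A *v x) + x \<bullet> (B *v x) = 0"
      using that by (simp add: matrix_vector_mult_add_rdistrib flip: inner_add_right)
    moreover have "0 \<le> x \<bullet> (A *v x)" "0 \<le> x \<bullet> (B *v x)"
      using assms by (auto simp: pos_semidef_def)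
    ultimately show ?thesis
      using assms pos_semidef_inner_zero_iff by (metis add_nonneg_eq_0_iff)
  qed
  then show ?thesis
    by (auto simp: ker_def matrix_vector_mult_add_rdistrib)
qed

section \<open>Splitting a positive semi-definite matrix\<close>

text \<open>
  The forms of \<open>A\<close> and \<open>B\<close> do not see the component of a vector in \<open>ker A\<close>, so they are
  determined by their values on the unit sphere \<open>K\<close> of the orthogonal complement of \<open>ker A\<close>. On
  \<open>K\<close> the form of \<open>A\<close> is positive, hence the ratio of \<open>B\<close> to \<open>A\<close> has a maximum there. Its
  reciprocal is the largest \<open>c\<close> with \<open>A - c B\<close> positive semi-definite, and a maximizer is a vector
  that \<open>A - c B\<close> annihilates and \<open>A\<close> does not.
\<close>

lemma exists_larger_kernel:
  fixes A B :: "complex^'n^'n"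
  assumes A: "pos_semidef A" and B: "pos_semidef B"
    and sub: "ker A \<subseteq> ker B" and "ker B \<noteq> UNIV"
  obtains c where "c > 0" "pos_semidef (A - c *\<^sub>R B)" "ker A \<subset> ker (A - c *\<^sub>R B)"
proof -
  define a where "a x = x \<bullet> (A *v x)" for x
  define b where "b x = x \<bullet> (B *v x)" for x
  have hA: "(A *v v) \<bullet> w = v \<bullet> (A *v w)" and hB: "(B *v v) \<bullet> w = v \<bullet> (B *v w)" for v w
    using A B by (simp_all add: pos_semidef_def hermitian_iff_inner)
  define K where "K = {x. \<forall>y\<in>ker A. orthogonal y x} \<inter> sphere 0 1"
  have decomp: "\<exists>k y. x = k + y \<and> k \<in> ker A \<and> (\<forall>z\<in>ker A. orthogonal z y)" for x
    using orthogonal_subspace_decomp_exists[of "ker A" x] subspace_ker[of A]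
    by (metis orthogonal_commute span_eq_iff)
  have shift: "a (k + y) = a y" "b (k + y) = b y" if "k \<in> ker A" for k y
  proof -
    have "A *v k = 0" "B *v k = 0" using that sub by (auto simp: ker_def)
    then show "a (k + y) = a y" "b (k + y) = b y"
      using hA[of k y] hB[of k y]
      by (simp_all add: a_def b_def matrix_vector_right_distrib inner_add_left)
  qed
  have hom: "a (r *\<^sub>R x) = r\<^sup>2 * a x" "b (r *\<^sub>R x) = r\<^sup>2 * b x" for r x
    by (simp_all add: a_def b_def mult_vec_scaleR power2_eq_square)
  have nonneg: "0 \<le> a x" "0 \<le> b x" for x
    using A B by (simp_all add: a_def b_def pos_semidef_def)
  have a_pos: "a x > 0" if "x \<in> K" for x
  proof -
    have "x \<notin> ker A"
    proof
      assume "x \<in> ker A"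
      with that have "orthogonal x x" by (auto simp: K_def)
      with that show False by (auto simp: K_def orthogonal_self)
    qed
    then have "a x \<noteq> 0"
      using pos_semidef_inner_zero_iff[OF A] by (simp add: a_def ker_def)
    with nonneg(1)[of x] show ?thesis by simp
  qed
  have reduce: "\<exists>k y r. x = k + r *\<^sub>R y \<and> k \<in> ker A \<and> y \<in> K" if "x \<notin> ker A" for x
  proof -
    obtain k y where ky: "x = k + y" "k \<in> ker A" "\<forall>z\<in>ker A. orthogonal z y"
      using decomp by blast
    with that have "y \<noteq> 0" by auto
    then have "(1 / norm y) *\<^sub>R y \<in> K"
      using ky by (auto simp: K_def orthogonal_def)
    moreover have "x = k + norm y *\<^sub>R ((1 / norm y) *\<^sub>R y)"
      using ky \<open>y \<noteq> 0\<close> by simp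
    ultimately show ?thesis using ky by blast
  qed
  have "compact K"
  proof -
    have "closed {x. \<forall>y\<in>ker A. orthogonal y x}"
      by (intro closed_subspace subspace_orthogonal_to_vectors)
    then show ?thesis
      unfolding K_def by (intro closed_Int_compact) auto
  qed
  \<comment> \<open>A vector outside \<open>ker B\<close> shows that the maximal ratio is positive.\<close>
  obtain z where z: "z \<notin> ker B" using \<open>ker B \<noteq> UNIV\<close> by blast
  with sub obtain k w r where w: "z = k + r *\<^sub>R w" "k \<in> ker A" "w \<in> K"
    using reduce[of z] by blast
  have "b z \<noteq> 0"
    using z pos_semidef_inner_zero_iff[OF B] by (simp add: b_def ker_def)
  with w have bw: "b w > 0"
    using shift(2)[of k] hom(2)[of r w] nonneg(2)[of w] by (auto simp: less_le)
  have "continuous_on K (\<lambda>x. b x / a x)"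
  proof (rule continuous_on_divide)
    show "continuous_on K b" "continuous_on K a"
      unfolding a_def b_def by (intro continuous_intros)+
    show "\<forall>x\<in>K. a x \<noteq> 0"
      using a_pos by (metis less_irrefl)
  qed
  then obtain m where m: "m \<in> K" "\<And>x. x \<in> K \<Longrightarrow> b x / a x \<le> b m / a m"
    using continuous_attains_sup[OF \<open>compact K\<close>] w(3) by blast
  define c where "c = a m / b m"
  have "0 < b w / a w" using bw a_pos[OF w(3)] by simp
  also have "\<dots> \<le> b m / a m" using m w(3) by blast
  finally have bm: "b m > 0" using a_pos[OF m(1)] by (simp add: zero_less_divide_iff)
  have "c > 0" using bm a_pos[OF m(1)] by (simp add: c_def)
  have form: "x \<bullet> ((A - c *\<^sub>R B) *v x) = a x - c * b x" for x
    by (simp add: a_def b_def matrix_vector_mult_diff_rdistrib inner_diff_right)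
  have "a x - c * b x \<ge> 0" for x
  proof (cases "x \<in> ker A")
    case True
    then show ?thesis using shift[of x 0] by (simp add: a_def b_def)
  next
    case False
    then obtain k y r where y: "x = k + r *\<^sub>R y" "k \<in> ker A" "y \<in> K"
      using reduce by blast
    have "c * b y \<le> a y"
      using m(2)[OF y(3)] a_pos[OF y(3)] a_pos[OF m(1)] bm
      by (simp add: c_def field_simps)
    then have "r\<^sup>2 * (a y - c * b y) \<ge> 0" by simp
    then show ?thesis
      using y by (simp add: shift hom algebra_simps)
  qed
  then have psd: "pos_semidef (A - c *\<^sub>R B)"
    using A B form by (simp add: pos_semidef_def hermitian_diff hermitian_scaleR)
  have "m \<bullet> ((A - c *\<^sub>R B) *v m) = 0"
    unfolding form using bm by (simp add: c_def)
  then have "m \<in> ker (A - c *\<^sub>R B)"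
    using pos_semidef_inner_zero_iff[OF psd] by (simp add: ker_def)
  moreover have "m \<notin> ker A"
    using a_pos[OF m(1)] by (auto simp: a_def ker_def)
  moreover have "ker A \<subseteq> ker (A - c *\<^sub>R B)"
    using sub by (auto simp: ker_def matrix_vector_mult_diff_rdistrib)
  ultimately show thesis
    using that \<open>c > 0\<close> psd by blast
qed

section \<open>Orthogonal projections\<close>

text \<open>
  The right-hand side describes \<open>P x\<close> for each \<open>x\<close> separately, as the foot of the perpendicular
  from \<open>x\<close> to \<open>E\<close>. Existence and uniqueness of the projection matrix thereby reduce to those of
  perpendiculars.
\<close>

lemma orthogonal_projection_onto_iff:
  fixes P :: "complex^'n^'n"
  assumes "vec.subspace E"
  shows "orthogonal_projection P \<and> range ((*v) P) = E \<longleftrightarrow>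
    (\<forall>x. P *v x \<in> E \<and> (\<forall>y\<in>E. orthogonal y (x - P *v x)))" (is "?L \<longleftrightarrow> ?R")
proof
  assume L: ?L
  have "orthogonal y (x - P *v x)" if "y \<in> E" for x y
  proof -
    obtain z where z: "y = P *v z" using L \<open>y \<in> E\<close> by blast
    have "P *v (x - P *v x) = 0"
      using L by (simp add: orthogonal_projection_def matrix_vector_mult_diff_distrib
          matrix_vector_mul_assoc)
    moreover have "y \<bullet> (x - P *v x) = z \<bullet> (P *v (x - P *v x))"
      using L unfolding z orthogonal_projection_def hermitian_iff_inner by blast
    ultimately show ?thesis by (simp add: orthogonal_def)
  qed
  then show ?R using L by blast
next
  assume R: ?R
  have E: "subspace E" using assms by (rule vec_subspace_imp_subspace)
  have fixed: "P *v y = y" if "y \<in> E" for y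
  proof -
    have "y - P *v y \<in> E" using R that by (intro subspace_diff[OF E]) simp_all
    then have "orthogonal (y - P *v y) (y - P *v y)" using R by blast
    then show ?thesis by (simp add: orthogonal_self)
  qed
  have half: "(P *v x) \<bullet> y = (P *v x) \<bullet> (P *v y)" for x y
  proof -
    have "orthogonal (P *v x) (y - P *v y)" using R by blast
    then show ?thesis by (simp add: orthogonal_def inner_diff_right)
  qed
  have "(P *v x) \<bullet> y = x \<bullet> (P *v y)" for x y
    using half[of x y] half[of y x] by (simp add: inner_commute)
  then have "hermitian P" by (simp add: hermitian_iff_inner)
  moreover have "P ** P = P"
    unfolding matrix_eq matrix_vector_mul_assoc[symmetric]
    using R by (intro allI fixed) blast
  moreover have "range ((*v) P) = E"
  proof
    show "range ((*v) P) \<subseteq> E" using R by blast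
    show "E \<subseteq> range ((*v) P)"
    proof
      fix y assume "y \<in> E"
      then have "y = P *v y" by (simp add: fixed)
      then show "y \<in> range ((*v) P)" by (rule range_eqI)
    qed
  qed
  ultimately show ?L by (simp add: orthogonal_projection_def)
qed

text \<open>
  Perpendiculars with respect to the real inner product exist and are unique. Their foot depends
  complex linearly on \<open>x\<close>, and so is given by a matrix: a complex subspace \<open>E\<close> is invariant under
  \<open>cnj c\<close>, therefore its real orthogonal complement is invariant under \<open>c\<close>.
\<close>

lemma ex1_orthogonal_projection_onto:
  fixes E :: "(complex^'n) set"
  assumes "vec.subspace E"
  shows "\<exists>!P. orthogonal_projection P \<and> range ((*v) P) = E"
proof -
  have E: "subspace E" using assms by (rule vec_subspace_imp_subspace)
  define proj where "proj x y \<longleftrightarrow> y \<in> E \<and> (\<forall>z\<in>E. orthogonal z (x - y))" for x y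
  have ex: "\<exists>y. proj x y" for x
  proof -
    obtain y z where "y \<in> span E" "\<And>w. w \<in> span E \<Longrightarrow> orthogonal z w" "x = y + z"
      using orthogonal_subspace_decomp_exists by metis
    then show ?thesis
      using E unfolding proj_def
      by (metis add_diff_cancel_left' orthogonal_commute span_eq_iff)
  qed
  have uniq: "y = y'" if "proj x y" "proj x y'" for x y y'
  proof -
    have "y - y' \<in> E" using that E by (auto simp: proj_def subspace_diff)
    then have "(y - y') \<bullet> (x - y) = 0" "(y - y') \<bullet> (x - y') = 0"
      using that by (auto simp: proj_def orthogonal_def)
    then have "(y - y') \<bullet> (y - y') = 0" by (simp add: inner_diff_right)
    then show ?thesis by simp
  qed
  obtain f where f: "\<And>x. proj x (f x)" using ex by metis
  have smult_adj: "y \<bullet> (c *s z) = (cnj c *s y) \<bullet> z" for c and y z :: "complex^'n"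
    by (simp add: inner_vec_def inner_complex_def algebra_simps)
  have "proj (x + x') (f x + f x')" for x x'
    using f[of x] f[of x'] assms
    by (auto simp: proj_def vec.subspace_def orthogonal_def inner_diff_right inner_add_right)
  note add = this
  have "proj (c *s x) (c *s f x)" for c x
  proof -
    have "orthogonal z (c *s x - c *s f x)" if "z \<in> E" for z
    proof -
      have "cnj c *s z \<in> E" using assms that by (simp add: vec.subspace_def)
      then have "orthogonal (cnj c *s z) (x - f x)" using f by (simp add: proj_def)
      then have "orthogonal z (c *s (x - f x))" by (simp only: orthogonal_def smult_adj)
      then show ?thesis by (simp only: vec.scale_right_diff_distrib)
    qed
    then show ?thesis
      using f[of x] assms by (simp add: proj_def vec.subspace_def)
  qed
  note scale = this
  have "Vector_Spaces.linear (*s) (*s) f"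
    by unfold_locales (rule uniq[OF f] add scale)+
  then have "\<And>x. matrix f *v x = f x" by (rule matrix_works)
  then have "\<forall>x. proj x (matrix f *v x)" using f by simp
  then have "\<exists>!P. \<forall>x. proj x (P *v x)"
  proof (rule ex1I)
    fix P assume P: "\<forall>x. proj x (P *v x)"
    have "P *v x = matrix f *v x" for x
      by (rule uniq[of x]) (use P \<open>\<forall>x. proj x (matrix f *v x)\<close> in simp_all)
    then show "P = matrix f" by (simp add: matrix_eq)
  qed
  then show ?thesis
    by (simp only: orthogonal_projection_onto_iff[OF assms] proj_def)
qed

lemma
  assumes "vec.subspace E"
  shows orthogonal_projection_projection_onto: "orthogonal_projection (projection_onto E)"
    and range_projection_onto: "range ((*v) (projection_onto E)) = E"
  using theI'[OF ex1_orthogonal_projection_onto[OF assms]]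
  by (simp_all add: projection_onto_def)

lemma projection_onto_zero: "projection_onto {0} = 0"
proof -
  have "vec.subspace {0 :: complex^'n}" by (simp add: vec.subspace_def)
  moreover have "orthogonal_projection (0 :: complex^'n^'n) \<and> range ((*v) (0 :: complex^'n^'n)) = {0}"
    by (auto simp: orthogonal_projection_def)
  ultimately show ?thesis
    unfolding projection_onto_def
    by (intro the1_equality ex1_orthogonal_projection_onto)
qed

text \<open>
  For an orthogonal projection \<open>P\<close> the form \<open>x \<bullet> P x\<close> is \<open>|P x|\<^sup>2\<close>, so the order compares the
  lengths of the projected vectors, and a vector lies in the range if and only if projecting does
  not shorten it.
\<close>

lemma pos_semidef_projection_diff_iff:
  assumes E: "vec.subspace E" and F: "vec.subspace F"
  shows "pos_semidef (projection_onto F - projection_onto E) \<longleftrightarrow> E \<subseteq> F"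
proof -
  define P where "P = projection_onto E"
  define Q where "Q = projection_onto F"
  have P: "hermitian P" "\<And>x. P *v (P *v x) = P *v x" "range ((*v) P) = E"
    using orthogonal_projection_projection_onto[OF E] range_projection_onto[OF E]
    by (simp_all add: P_def orthogonal_projection_def matrix_vector_mul_assoc)
  have Q: "hermitian Q" "\<And>x. Q *v (Q *v x) = Q *v x" "range ((*v) Q) = F"
    using orthogonal_projection_projection_onto[OF F] range_projection_onto[OF F]
    by (simp_all add: Q_def orthogonal_projection_def matrix_vector_mul_assoc)
  have nP: "x \<bullet> (P *v x) = (norm (P *v x))\<^sup>2" and nQ: "x \<bullet> (Q *v x) = (norm (Q *v x))\<^sup>2" for x
    using P(1,2) Q(1,2) by (simp_all add: hermitian_iff_inner power2_norm_eq_inner)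
  have fixP: "P *v y = y" if "y \<in> E" for y using that P by blast
  have fixQ: "Q *v y = y" if "y \<in> F" for y using that Q by blast
  have "pos_semidef (Q - P) \<longleftrightarrow> (\<forall>x. norm (P *v x) \<le> norm (Q *v x))"
    using P(1) Q(1)
    by (simp add: pos_semidef_def hermitian_diff matrix_vector_mult_diff_rdistrib
        inner_diff_right nP nQ)
  also have "\<dots> \<longleftrightarrow> E \<subseteq> F"
  proof
    assume le: "\<forall>x. norm (P *v x) \<le> norm (Q *v x)"
    show "E \<subseteq> F"
    proof
      fix x assume "x \<in> E"
      with le have "norm x \<le> norm (Q *v x)" by (metis fixP)
      then have "(norm x)\<^sup>2 \<le> (norm (Q *v x))\<^sup>2" by (simp add: power_mono)
      then have "(norm (x - Q *v x))\<^sup>2 \<le> 0"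
        using nQ[of x]
        by (simp add: power2_norm_eq_inner inner_diff_left inner_diff_right inner_commute)
      then have "x = Q *v x" by simp
      then show "x \<in> F" using Q(3) by blast
    qed
  next
    assume "E \<subseteq> F"
    show "\<forall>x. norm (P *v x) \<le> norm (Q *v x)"
    proof
      fix x
      have "P *v x \<in> F" using P(3) \<open>E \<subseteq> F\<close> by blast
      then have "(norm (P *v x))\<^sup>2 = (P *v x) \<bullet> (Q *v x)"
        using nP[of x] Q(1) fixQ[of "P *v x"]
        by (simp add: hermitian_iff_inner) (metis inner_commute)
      also have "\<dots> \<le> norm (P *v x) * norm (Q *v x)"
        by (rule norm_cauchy_schwarz)
      finally show "norm (P *v x) \<le> norm (Q *v x)"
        by (cases "norm (P *v x) = 0") (auto simp: power2_eq_square)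
    qed
  qed
  finally show ?thesis by (simp add: P_def Q_def)
qed

section \<open>Ground spaces\<close>

text \<open>
  The kernel of a positive definite element of \<open>S\<close> is the zero space, which is the eigenspace for
  the least eigenvalue of no hermitian matrix. It is included because its projection \<open>0\<close> is an element of the
  lattice.
\<close>

definition ground_spaces :: "(complex^'n^'n) set \<Rightarrow> (complex^'n) set set" where
  "ground_spaces S = ker ` {s \<in> S. pos_semidef s}"

lemma eigenspace_of_real: "eigenspace A (complex_of_real l) = ker (A - l *\<^sub>R mat 1)"
  by (auto simp: eigenspace_def ker_def matrix_vector_mult_diff_rdistrib of_real_smult_eq_scaleR)

lemma least_eigenvalue_eqI:
  assumes psd: "pos_semidef (A - l *\<^sub>R mat 1)" and ne: "ker (A - l *\<^sub>R mat 1) \<noteq> {0}"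
  shows "least_eigenvalue A = l"
  unfolding least_eigenvalue_def
proof (rule Least_equality)
  have "0 \<in> ker (A - l *\<^sub>R mat 1)" by (simp add: ker_def)
  with ne show "eigenvalue A (complex_of_real l)"
    unfolding eigenvalue_def eigenspace_of_real by blast
next
  fix k assume "eigenvalue A (complex_of_real k)"
  then obtain x where x: "A *v x = k *\<^sub>R x" "x \<noteq> 0"
    by (auto simp: eigenvalue_def eigenspace_def of_real_smult_eq_scaleR)
  have "0 \<le> x \<bullet> ((A - l *\<^sub>R mat 1) *v x)" using psd by (simp add: pos_semidef_def)
  then have "0 \<le> (k - l) * (x \<bullet> x)"
    by (simp add: matrix_vector_mult_diff_rdistrib x inner_diff_right algebra_simps)
  moreover have "x \<bullet> x > 0" using x(2) by simp
  ultimately show "l \<le> k"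
    by (simp add: zero_le_mult_iff)
qed

text \<open>
  The least eigenvalue is the minimum \<open>l\<close> of \<open>x \<bullet> A x\<close> over the unit sphere: the form of
  \<open>A - l 1\<close> is nonnegative and vanishes at a minimizer, which therefore lies in the kernel.
\<close>

lemma exists_minimal_shift:
  fixes A :: "complex^'n^'n"
  assumes "hermitian A"
  obtains l where "pos_semidef (A - l *\<^sub>R mat 1)" "ker (A - l *\<^sub>R mat 1) \<noteq> {0}"
proof -
  have "continuous_on (sphere 0 1) (\<lambda>x. x \<bullet> (A *v x))"
    by (intro continuous_intros)
  moreover have "sphere (0 :: complex^'n) 1 \<noteq> {}" by simp
  ultimately obtain m where m: "norm m = 1"
      "\<And>x. norm x = 1 \<Longrightarrow> m \<bullet> (A *v m) \<le> x \<bullet> (A *v x)"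
    using continuous_attains_inf[of "sphere (0 :: complex^'n) 1" "\<lambda>x. x \<bullet> (A *v x)"] by auto
  define l where "l = m \<bullet> (A *v m)"
  have "0 \<le> x \<bullet> ((A - l *\<^sub>R mat 1) *v x)" for x
  proof (cases "x = 0")
    case False
    have "l \<le> (x /\<^sub>R norm x) \<bullet> (A *v (x /\<^sub>R norm x))"
      unfolding l_def using False by (intro m(2)) simp
    also have "\<dots> = (x \<bullet> (A *v x)) / (norm x)\<^sup>2"
      by (simp add: mult_vec_scaleR power2_eq_square field_simps)
    finally have "l * (norm x)\<^sup>2 \<le> x \<bullet> (A *v x)"
      using False by (simp add: field_simps)
    then show ?thesis
      by (simp add: matrix_vector_mult_diff_rdistrib inner_diff_right power2_norm_eq_inner)
  qed simp
  then have psd: "pos_semidef (A - l *\<^sub>R mat 1)"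
    using assms by (simp add: pos_semidef_def hermitian_diff hermitian_scaleR)
  have "m \<bullet> m = 1" using m(1) by (simp add: norm_eq_1)
  then have "m \<bullet> ((A - l *\<^sub>R mat 1) *v m) = 0"
    by (simp add: matrix_vector_mult_diff_rdistrib inner_diff_right l_def)
  then have "m \<in> ker (A - l *\<^sub>R mat 1)"
    using pos_semidef_inner_zero_iff[OF psd] by (simp add: ker_def)
  moreover have "m \<noteq> 0" using m(1) by auto
  ultimately show thesis using that psd by blast
qed

lemma ground_projections_eq:
  assumes "operator_system S"
  shows "ground_projections S = projection_onto ` ground_spaces S"
proof
  have S: "cmat.subspace S" "mat 1 \<in> S"
    using assms by (simp_all add: operator_system_def)
  show "ground_projections S \<subseteq> projection_onto ` ground_spaces S"
  proof
    fix p assume "p \<in> ground_projections S"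
    then consider "p = 0" | u where "u \<in> S" "hermitian u" "p = ground_projection u"
      by (auto simp: ground_projections_def hermitian_part_def)
    then show "p \<in> projection_onto ` ground_spaces S"
    proof cases
      case 1
      have "ker (mat 1) \<in> ground_spaces S" using S(2) unfolding ground_spaces_def by (intro imageI) simp
      then show ?thesis using 1 projection_onto_zero by (metis imageI ker_one)
    next
      case 2
      obtain l where l: "pos_semidef (u - l *\<^sub>R mat 1)" "ker (u - l *\<^sub>R mat 1) \<noteq> {0}"
        using exists_minimal_shift[OF 2(2)] by blast
      have "u - l *\<^sub>R mat 1 \<in> S"
        using S 2(1) by (simp add: scaleR_eq_cmat_scale cmat.subspace_diff cmat.subspace_scale)
      moreover have "p = projection_onto (ker (u - l *\<^sub>R mat 1))"
        using 2(3) least_eigenvalue_eqI[OF l] by (simp add: ground_projection_def eigenspace_of_real)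
      ultimately show ?thesis using l by (auto simp: ground_spaces_def)
    qed
  qed
  show "projection_onto ` ground_spaces S \<subseteq> ground_projections S"
  proof
    fix p assume "p \<in> projection_onto ` ground_spaces S"
    then obtain s where s: "s \<in> S" "pos_semidef s" "p = projection_onto (ker s)"
      by (auto simp: ground_spaces_def)
    show "p \<in> ground_projections S"
    proof (cases "ker s = {0}")
      case True
      then show ?thesis using s by (simp add: projection_onto_zero ground_projections_def)
    next
      case False
      then have "least_eigenvalue s = 0"
        using s by (intro least_eigenvalue_eqI) simp_all
      then have "p = ground_projection s"
        using s eigenspace_of_real[of s 0] by (simp add: ground_projection_def)
      then show ?thesis
        using s by (auto simp: ground_projections_def hermitian_part_def pos_semidef_def)
    qed
  qed
qed

lemma UNIV_in_ground_spaces: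
  assumes "operator_system S"
  shows "UNIV \<in> ground_spaces S"
proof -
  have "0 \<in> S" using assms by (simp add: operator_system_def cmat.subspace_0)
  then show ?thesis unfolding ground_spaces_def
    by (intro image_eqI[of _ _ 0]) simp_all
qed

lemma Int_in_ground_spaces:
  assumes "operator_system S" "E \<in> ground_spaces S" "F \<in> ground_spaces S"
  shows "E \<inter> F \<in> ground_spaces S"
proof -
  obtain s t where "s \<in> S" "pos_semidef s" "E = ker s" "t \<in> S" "pos_semidef t" "F = ker t"
    using assms(2,3) by (auto simp: ground_spaces_def)
  moreover from this have "s + t \<in> S"
    using assms(1) by (simp add: operator_system_def cmat.subspace_add)
  ultimately show ?thesis
    unfolding ground_spaces_def
    by (intro image_eqI[of _ _ "s + t"]) (simp_all add: ker_add pos_semidef_add)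
qed

lemma ground_space_splits:
  assumes S: "operator_system S" and "E \<in> ground_spaces S" "F \<in> ground_spaces S"
    and "E \<subset> F" "F \<noteq> UNIV"
  shows "\<exists>D\<in>ground_spaces S. E \<subset> D \<and> D \<inter> F = E"
proof -
  obtain s t where s: "s \<in> S" "pos_semidef s" "E = ker s" and t: "t \<in> S" "pos_semidef t" "F = ker t"
    using assms by (auto simp: ground_spaces_def)
  obtain c where c: "c > 0" "pos_semidef (s - c *\<^sub>R t)" "ker s \<subset> ker (s - c *\<^sub>R t)"
    using exists_larger_kernel[of s t] s t assms by blast
  have "s - c *\<^sub>R t \<in> S"
    using S s t
    by (simp add: operator_system_def scaleR_eq_cmat_scale cmat.subspace_diff cmat.subspace_scale)
  moreover have "ker (s - c *\<^sub>R t) \<inter> F = E"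
    using assms(4) c(3) s t by (auto simp: ker_def matrix_vector_mult_diff_rdistrib)
  ultimately show ?thesis
    using c s by (auto simp: ground_spaces_def)
qed

section \<open>Lattices of subspaces\<close>

text \<open>
  The set \<open>X\<close> stands for a lower bound of the coatoms above \<open>E\<close>. The induction is on the
  codimension of \<open>E\<close>: a member that is neither a coatom nor the whole space is the intersection
  of two strictly larger members, and the coatoms above either of those are also above \<open>E\<close>.
\<close>

lemma coatoms_separate:
  fixes G :: "'a::euclidean_space set set"
  assumes sub: "\<And>E. E \<in> G \<Longrightarrow> subspace E"
    and splits: "\<And>E F. E \<in> G \<Longrightarrow> F \<in> G \<Longrightarrow> E \<subset> F \<Longrightarrow> F \<noteq> UNIV \<Longrightarrow> \<exists>D\<in>G. E \<subset> D \<and> D \<inter> F = E"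
    and "E \<in> G"
    and "\<And>C. C \<in> G \<Longrightarrow> C \<noteq> UNIV \<Longrightarrow> (\<And>D. D \<in> G \<Longrightarrow> C \<subset> D \<Longrightarrow> D = UNIV) \<Longrightarrow> E \<subseteq> C \<Longrightarrow> X \<subseteq> C"
  shows "X \<subseteq> E"
  using assms(3,4)
proof (induction E rule: measure_induct_rule[of "\<lambda>E. DIM('a) - dim E"])
  case (less E)
  have larger: "X \<subseteq> D" if "D \<in> G" "E \<subset> D" for D
  proof (rule less.IH)
    have "dim E < dim D"
      using that less.prems(1) sub by (metis dim_psubset span_eq_iff)
    then show "DIM('a) - dim D < DIM('a) - dim E"
      using dim_subset_UNIV[of D] by linarith
  qed (use that less.prems(2) in auto)
  consider "E = UNIV" | "E \<noteq> UNIV" "\<And>D. D \<in> G \<Longrightarrow> E \<subset> D \<Longrightarrow> D = UNIV"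
    | F where "F \<in> G" "E \<subset> F" "F \<noteq> UNIV"
    by blast
  then show ?case
  proof cases
    case 2
    then show ?thesis using less.prems by blast
  next
    case (3 F)
    then obtain D where "D \<in> G" "E \<subset> D" "D \<inter> F = E"
      using splits less.prems(1) by metis
    then show ?thesis using larger 3 by blast
  qed simp
qed

text \<open>
  A member of least dimension above \<open>X\<close> is contained in all others, since intersecting it with one
  that does not contain it would lower the dimension. This provides suprema.
\<close>

lemma least_member_above:
  fixes G :: "'a::euclidean_space set set"
  assumes sub: "\<And>E. E \<in> G \<Longrightarrow> subspace E"
    and UNIV: "UNIV \<in> G" and Int: "\<And>E F. E \<in> G \<Longrightarrow> F \<in> G \<Longrightarrow> E \<inter> F \<in> G"
  shows "\<exists>M\<in>G. X \<subseteq> M \<and> (\<forall>E\<in>G. X \<subseteq> E \<longrightarrow> M \<subseteq> E)"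
proof -
  obtain M where M: "M \<in> G" "X \<subseteq> M" "\<And>E. E \<in> G \<Longrightarrow> X \<subseteq> E \<Longrightarrow> dim M \<le> dim E"
    using ex_has_least_nat[of "\<lambda>E. E \<in> G \<and> X \<subseteq> E" UNIV dim] UNIV by auto
  have "M \<subseteq> E" if "E \<in> G" "X \<subseteq> E" for E
  proof (rule ccontr)
    assume "\<not> M \<subseteq> E"
    then have "M \<inter> E \<subset> M" by blast
    moreover have "M \<inter> E \<in> G" using Int M(1) that(1) by blast
    ultimately have "dim (M \<inter> E) < dim M"
      using M(1) sub by (metis dim_psubset span_eq_iff)
    then show False using M that \<open>M \<inter> E \<in> G\<close> by (metis Int_greatest leD)
  qed
  then show ?thesis using M by blast
qed

text \<open>
  The order \<open>L\<close> is a copy of the family \<open>G\<close> along \<open>p\<close>; the intended \<open>p\<close> sends a subspace to its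
  orthogonal projection.
\<close>

lemma coatomistic_lattice_of_subspaces:
  fixes G :: "'a::euclidean_space set set" and p :: "'a set \<Rightarrow> 'b" and L :: "'b gorder"
  assumes sub: "\<And>E. E \<in> G \<Longrightarrow> subspace E"
    and UNIV: "UNIV \<in> G" and Int: "\<And>E F. E \<in> G \<Longrightarrow> F \<in> G \<Longrightarrow> E \<inter> F \<in> G"
    and splits: "\<And>E F. E \<in> G \<Longrightarrow> F \<in> G \<Longrightarrow> E \<subset> F \<Longrightarrow> F \<noteq> UNIV \<Longrightarrow> \<exists>D\<in>G. E \<subset> D \<and> D \<inter> F = E"
    and carrier: "carrier L = p ` G" and eq: "eq L = (=)"
    and le: "\<And>E F. E \<in> G \<Longrightarrow> F \<in> G \<Longrightarrow> le L (p E) (p F) \<longleftrightarrow> E \<subseteq> F"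
  shows "coatomistic_lattice L"
proof -
  have inj: "p E = p F \<longleftrightarrow> E = F" if "E \<in> G" "F \<in> G" for E F
    using le[of E F] le[of F E] le[of E E] that by auto
  interpret partial_order L
    by unfold_locales (auto simp: carrier eq le)
  have top: "greatest L (p UNIV) (carrier L)"
    by (auto simp: greatest_def carrier le UNIV)
  interpret weak_partial_order_top L
    by unfold_locales (use top in blast)
  have top_eq: "\<top>\<^bsub>L\<^esub> = p UNIV"
    using greatest_unique[OF top_greatest top] eq by simp
  interpret Lattice.lattice L
  proof unfold_locales
    fix x y assume "x \<in> carrier L" "y \<in> carrier L"
    then obtain E F where EF: "E \<in> G" "F \<in> G" "x = p E" "y = p F" by (auto simp: carrier)
    obtain M where "M \<in> G" "E \<union> F \<subseteq> M" "\<forall>D\<in>G. E \<union> F \<subseteq> D \<longrightarrow> M \<subseteq> D"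
      using least_member_above[of G "E \<union> F"] sub UNIV Int by metis
    then have "least L (p M) (Upper L {x, y})"
      using EF by (auto simp: least_def Upper_def carrier le)
    then show "\<exists>s. least L s (Upper L {x, y})" ..
    have "greatest L (p (E \<inter> F)) (Lower L {x, y})"
      using EF Int by (auto simp: greatest_def Lower_def carrier le)
    then show "\<exists>s. greatest L s (Lower L {x, y})" ..
  qed
  have coatom: "coatom L (p C) \<longleftrightarrow> C \<noteq> UNIV \<and> (\<forall>D\<in>G. C \<subset> D \<longrightarrow> D = UNIV)" if "C \<in> G" for C
    using that UNIV by (auto simp: coatom_def top_eq carrier le inj)
  show ?thesis
  proof unfold_locales
    fix x assume "x \<in> carrier L"
    then obtain E where E: "E \<in> G" "x = p E" by (auto simp: carrier)
    let ?C = "{c. coatom L c \<and> x \<sqsubseteq>\<^bsub>L\<^esub> c}"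
    have "y \<sqsubseteq>\<^bsub>L\<^esub> x" if y: "y \<in> Lower L ?C" for y
    proof -
      obtain X where X: "X \<in> G" "y = p X" using y by (auto simp: Lower_def carrier)
      have "X \<subseteq> E"
      proof (rule coatoms_separate[OF sub splits E(1)])
        fix C assume C: "C \<in> G" "C \<noteq> UNIV" "\<And>D. D \<in> G \<Longrightarrow> C \<subset> D \<Longrightarrow> D = UNIV" "E \<subseteq> C"
        then have "p C \<in> ?C" using E by (auto simp: coatom le)
        then have "y \<sqsubseteq>\<^bsub>L\<^esub> p C" using y C(1) by (auto simp: Lower_def carrier)
        then show "X \<subseteq> C" using X C(1) by (simp add: le)
      qed
      then show ?thesis using E X by (simp add: le)
    qed
    moreover have "x \<in> Lower L ?C"
      using \<open>x \<in> carrier L\<close> by (simp add: Lower_def)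
    moreover have "Lower L ?C \<subseteq> carrier L"
      by (simp add: Lower_def)
    ultimately show "is_glb L x ?C"
      by (simp add: greatest_def)
  qed
qed

theorem corollary6p5:
  fixes S :: "(complex^'n^'n) set"
  assumes "operator_system S"
  shows "coatomistic_lattice (ground_projection_order S)"
proof (rule coatomistic_lattice_of_subspaces[where G = "ground_spaces S" and p = projection_onto])
  have cs: "vec.subspace E" if "E \<in> ground_spaces S" for E
    using that vec_subspace_ker by (auto simp: ground_spaces_def)
  then show "subspace E" if "E \<in> ground_spaces S" for E
    using that vec_subspace_imp_subspace by blast
  show "carrier (ground_projection_order S) = projection_onto ` ground_spaces S"
    using assms by (simp add: ground_projection_order_def ground_projections_eq)
  show "eq (ground_projection_order S) = (=)"
    by (simp add: ground_projection_order_def)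
  show "le (ground_projection_order S) (projection_onto E) (projection_onto F) \<longleftrightarrow> E \<subseteq> F"
    if "E \<in> ground_spaces S" "F \<in> ground_spaces S" for E F
    using that cs by (simp add: ground_projection_order_def pos_semidef_projection_diff_iff)
qed (fact UNIV_in_ground_spaces[OF assms] Int_in_ground_spaces[OF assms] ground_space_splits[OF assms])+

end
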